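(* Let $(E,w,d)$ be an ultra triple, $C\subseteq E$ a finite subset, and $m,r$ non-negative integers. Let $(c_1,\dots,c_m)$ be any greedy $r$-removed $m$-permutation of $C$. Then for each $k\in\{0,1,\dots,m\}$, the set $\{c_1,\dots,c_k\}$ has maximum $r$-removed perimeter among all $k$-element subsets of $C$.
   Context: An ultra triple $(E,w,d)$ consists of a set $E$, an arbitrary function $w:E\to\mathbb{R}$, and a function $d$ defined on pairs of distinct points of $E$ with real values such that $d(a,b)=d(b,a)$ and $d(a,b)\le\max\{d(a,c),d(b,c)\}$ for all pairwise distinct $a,b,c\in E$ (distances may be negative). For a finite set $C\subseteq E$ and $v\in E\setminus C$, $\operatorname{dist}_r(C,v)$ is the maximum over all $S\subseteq C$ with $|S|=|C|-r$ of $\sum_{x\in S}d(v,x)$ if $|C|>r$, and $0$ if $|C|\le r$. For an ordered list $(a_1,\dots,a_k)$ of distinct points, $\operatorname{per}_r((a_1,\dots,a_k))=\sum_{i=1}^k w(a_i)+\sum_{i=1}^k\operatorname{dist}_r(\{a_1,\dots,a_{i-1}\},a_i)$; this value does not depend on the ordering, and for a finite set $A$ one writes $\operatorname{per}_r(A)$ for the common value over all orderings of $A$. A greedy $r$-removed $m$-permutation of a finite set $C$ is a list $(c_1,\dots,c_m)$ of $m$ distinct elements of $C$ such that for each $i\in\{1,\dots,m\}$ and each $x\in C\setminus\{c_1,\dots,c_{i-1}\}$ one has $\operatorname{per}_r((c_1,\dots,c_i))\ge\operatorname{per}_r((c_1,\dots,c_{i-1},x))$. *)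

theory Defs
  imports Complex_Main
begin

(* w is unconstrained. The function d is total in HOL, but only its values at pairs of distinct
   points of E are meaningful: nothing is assumed about the diagonal. *)
definition ultra_triple :: "'a set \<Rightarrow> ('a \<Rightarrow> real) \<Rightarrow> ('a \<Rightarrow> 'a \<Rightarrow> real) \<Rightarrow> bool" where
  "ultra_triple E w d \<longleftrightarrow>
     (\<forall>a\<in>E. \<forall>b\<in>E. a \<noteq> b \<longrightarrow> d a b = d b a) \<and>
     (\<forall>a\<in>E. \<forall>b\<in>E. \<forall>c\<in>E. a \<noteq> b \<longrightarrow> a \<noteq> c \<longrightarrow> b \<noteq> c \<longrightarrow> d a b \<le> max (d a c) (d b c))"

(* Meant for finite C and v not in C. *)
definition dist_removed :: "('a \<Rightarrow> 'a \<Rightarrow> real) \<Rightarrow> nat \<Rightarrow> 'a set \<Rightarrow> 'a \<Rightarrow> real" where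
  "dist_removed d r C v =
     (if card C > r then Max {\<Sum>x\<in>S. d v x |S. S \<subseteq> C \<and> card S = card C - r} else 0)"

(* Lists are indexed from 0, so the predecessors of xs ! i are the elements of take i xs. *)
definition per_list ::
  "('a \<Rightarrow> real) \<Rightarrow> ('a \<Rightarrow> 'a \<Rightarrow> real) \<Rightarrow> nat \<Rightarrow> 'a list \<Rightarrow> real" where
  "per_list w d r xs =
     (\<Sum>i<length xs. w (xs ! i)) +
     (\<Sum>i<length xs. dist_removed d r (set (take i xs)) (xs ! i))"

(* The common value of per_list over all orderings of the finite set A. In an ultra triple the
   value does not depend on the ordering, so the description is then well defined. *)
definition per_set ::
  "('a \<Rightarrow> real) \<Rightarrow> ('a \<Rightarrow> 'a \<Rightarrow> real) \<Rightarrow> nat \<Rightarrow> 'a set \<Rightarrow> real" where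
  "per_set w d r A = (THE p. \<forall>xs. distinct xs \<and> set xs = A \<longrightarrow> per_list w d r xs = p)"

definition greedy_removed_permutation ::
  "('a \<Rightarrow> real) \<Rightarrow> ('a \<Rightarrow> 'a \<Rightarrow> real) \<Rightarrow> nat \<Rightarrow> nat \<Rightarrow> 'a set \<Rightarrow> 'a list \<Rightarrow> bool" where
  "greedy_removed_permutation w d r m C cs \<longleftrightarrow>
     length cs = m \<and> distinct cs \<and> set cs \<subseteq> C \<and>
     (\<forall>i\<in>{1..m}. \<forall>x \<in> C - set (take (i - 1) cs).
        per_list w d r (take i cs) \<ge> per_list w d r (take (i - 1) cs @ [x]))"

definition max_perimeter_subset ::
  "('a \<Rightarrow> real) \<Rightarrow> ('a \<Rightarrow> 'a \<Rightarrow> real) \<Rightarrow> nat \<Rightarrow> nat \<Rightarrow> 'a set \<Rightarrow> 'a set \<Rightarrow> bool" where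
  "max_perimeter_subset w d r k C B \<longleftrightarrow>
     B \<subseteq> C \<and> card B = k \<and>
     (\<forall>A. A \<subseteq> C \<and> card A = k \<longrightarrow> per_set w d r A \<le> per_set w d r B)"

end

theory Submission
  imports Defs
begin

text \<open>
  If \<open>card B = card A + 1\<close>, then some \<open>u \<in> B - A\<close> satisfies
  \<open>dist\<^sub>r (B - {u}, u) \<le> dist\<^sub>r (A, u)\<close>: match the points of \<open>A - B\<close> one after the other with a
  nearest unused point of \<open>B - A\<close>, let \<open>u\<close> be a point that is left over, and use the ultrametric
  inequality to see that no point of \<open>A\<close> is closer to \<open>u\<close> than its partner. As \<open>w u\<close> contributes
  equally to both sides, \<open>per (A \<union> {u}) + per (B - {u}) \<ge> per A + per B\<close>. With \<open>A\<close> a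
  greedy set of maximum perimeter and \<open>B\<close> any set with one more point, this shows that the next
  greedy set has maximum perimeter too.
\<close>

section \<open>Removed distances in an ultra triple\<close>

lemma ultra_triple_sym:
  "\<lbrakk>ultra_triple E w d; a \<in> E; b \<in> E; a \<noteq> b\<rbrakk> \<Longrightarrow> d a b = d b a"
  unfolding ultra_triple_def by blast

lemma ultra_triple_max:
  "\<lbrakk>ultra_triple E w d; a \<in> E; b \<in> E; c \<in> E; a \<noteq> b; a \<noteq> c; b \<noteq> c\<rbrakk>
    \<Longrightarrow> d a b \<le> max (d a c) (d b c)"
  unfolding ultra_triple_def by blast

lemma dist_removed_ge:
  assumes "finite C" "S \<subseteq> C" "card S = card C - r"
  shows "(\<Sum>x\<in>S. d v x) \<le> dist_removed d r C v"
proof (cases "card C > r")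
  case True
  have "finite {\<Sum>x\<in>S. d v x |S. S \<subseteq> C \<and> card S = card C - r}"
    using assms(1) by simp
  then show ?thesis
    using True assms unfolding dist_removed_def by (auto intro: Max_ge)
next
  case False
  then have "S = {}"
    using assms finite_subset[of S C] by auto
  then show ?thesis
    using False by (simp add: dist_removed_def)
qed

text \<open>Together with \<open>dist_removed_ge\<close> this replaces the \<open>Max\<close> in the
  definition. Both also cover \<open>card C \<le> r\<close>, where truncated subtraction leaves only
  the empty set, whose sum is the default value 0.\<close>

lemma dist_removed_attained:
  assumes "finite C"
  obtains S where "S \<subseteq> C" "card S = card C - r" "dist_removed d r C v = (\<Sum>x\<in>S. d v x)"
proof (cases "card C > r")
  case True
  let ?M = "{\<Sum>x\<in>S. d v x |S. S \<subseteq> C \<and> card S = card C - r}"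
  have "finite ?M"
    using assms by simp
  moreover have "?M \<noteq> {}"
    using obtain_subset_with_card_n[of "card C - r" C] by auto
  ultimately have "Max ?M \<in> ?M"
    by (rule Max_in)
  then show ?thesis
    using True that unfolding dist_removed_def by auto
next
  case False
  then show ?thesis
    using that[of "{}"] by (simp add: dist_removed_def)
qed

text \<open>Half of the invariance of the perimeter under swapping two adjacent points. An optimal
  \<open>U\<close> for \<open>b\<close> has one point more than an optimal \<open>T\<close> for
  \<open>a\<close>; dropping one point from \<open>U\<close> and adding one to \<open>T\<close>
  gives admissible sets for the right-hand side.\<close>

lemma dist_removed_swap_le:
  assumes ut: "ultra_triple E w d" and "finite S" "S \<subseteq> E" "a \<in> E" "b \<in> E"
    and "a \<notin> S" "b \<notin> S" "a \<noteq> b"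
  shows "dist_removed d r S a + dist_removed d r (insert a S) b
       \<le> dist_removed d r S b + dist_removed d r (insert b S) a"
\<comment> \<open>If \<open>card S < r\<close>, even the enlarged sets have at most \<open>r\<close>
  points, so all four terms are 0.\<close>
proof (cases "card S < r")
  case True
  then show ?thesis
    using assms by (simp add: dist_removed_def)
next
  case False
  obtain T where T: "T \<subseteq> S" "card T = card S - r" "dist_removed d r S a = (\<Sum>x\<in>T. d a x)"
    using dist_removed_attained[OF \<open>finite S\<close>, of r d a] by blast
  obtain U where U: "U \<subseteq> insert a S" "card U = card (insert a S) - r"
      "dist_removed d r (insert a S) b = (\<Sum>x\<in>U. d b x)"
    using dist_removed_attained[of "insert a S" r d b] \<open>finite S\<close> by auto
  have fin: "finite T" "finite U"
    using T(1) U(1) \<open>finite S\<close> finite_subset by blast+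
  have cardU: "card U = Suc (card T)"
    using T(2) U(2) False assms by simp
  \<comment> \<open>The dropped point must be \<open>a\<close> whenever \<open>a\<close> lies in
    \<open>U\<close>, since the rest has to be a subset of \<open>S\<close>.\<close>
  have "\<exists>x. x \<in> U - T \<and> (a \<in> U \<longrightarrow> x = a)"
  proof (cases "a \<in> U")
    case True
    then show ?thesis using T(1) assms by blast
  next
    case False
    have "\<not> U \<subseteq> T"
      using card_mono[OF fin(1), of U] cardU by auto
    then show ?thesis using False by blast
  qed
  then obtain x where x: "x \<in> U" "x \<notin> T" "a \<in> U \<Longrightarrow> x = a"
    by blast
  have Ux: "U - {x} \<subseteq> S" "card (U - {x}) = card S - r"
    using x U(1) cardU T(2) fin by auto
  have U_le: "(\<Sum>y\<in>U. d b y) \<le> dist_removed d r S b + d b x"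
    using dist_removed_ge[OF \<open>finite S\<close> Ux, of d b] sum.remove[OF fin(2) x(1), of "d b"] by simp
  have T_le: "(\<Sum>y\<in>T. d a y) + d a z \<le> dist_removed d r (insert b S) a"
    if "z \<in> insert b S" "z \<notin> T" for z
  proof -
    have "insert z T \<subseteq> insert b S" "card (insert z T) = card (insert b S) - r"
      using that T fin False assms by auto
    from dist_removed_ge[OF _ this, of d a] show ?thesis
      using \<open>finite S\<close> fin that by simp
  qed
  have "b \<notin> T" using T(1) assms by blast
  have sym: "d b a = d a b"
    using ultra_triple_sym[OF ut, of b a] assms by auto
  show ?thesis
  \<comment> \<open>If \<open>x\<close> is no farther from \<open>b\<close> than \<open>a\<close>
    is, \<open>T\<close> gains \<open>b\<close>. Otherwise \<open>x\<close> differs from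
    \<open>a\<close>, and the ultrametric inequality forces \<open>d b x \<le> d a x\<close>, so
    \<open>T\<close> gains \<open>x\<close>.\<close>
  proof (cases "d b x \<le> d a b")
    case True
    then show ?thesis
      using U_le T_le[of b] \<open>b \<notin> T\<close> T(3) U(3) by simp
  next
    case False
    then have "x \<noteq> a" using sym by auto
    then have "x \<in> S" using x U(1) by auto
    then have xx: "x \<noteq> b" "x \<in> E" using assms by auto
    have "d b x \<le> max (d b a) (d x a)"
      using ultra_triple_max[OF ut, of b x a] xx assms \<open>x \<noteq> a\<close> by auto
    moreover have "d x a = d a x"
      using ultra_triple_sym[OF ut, of x a] xx assms \<open>x \<noteq> a\<close> by auto
    ultimately have "d b x \<le> d a x"
      using False sym by auto
    then show ?thesis
      using U_le T_le[of x] \<open>x \<in> S\<close> x(2) T(3) U(3) by simp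
  qed
qed

lemma dist_removed_swap:
  assumes "ultra_triple E w d" "finite S" "S \<subseteq> E" "a \<in> E" "b \<in> E"
    and "a \<notin> S" "b \<notin> S" "a \<noteq> b"
  shows "dist_removed d r S a + dist_removed d r (insert a S) b
       = dist_removed d r S b + dist_removed d r (insert b S) a"
  using dist_removed_swap_le[of E w d S a b r] dist_removed_swap_le[of E w d S b a r] assms
  by fastforce

section \<open>Order independence of the perimeter\<close>

lemma per_list_snoc:
  "per_list w d r (xs @ [a]) = per_list w d r xs + w a + dist_removed d r (set xs) a"
  by (simp add: per_list_def nth_append)

lemma per_list_cong_set:
  assumes "ultra_triple E w d" "distinct xs" "distinct ys" "set xs = set ys" "set xs \<subseteq> E"
  shows "per_list w d r xs = per_list w d r ys"
  using assms(2-)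
proof (induction "length xs" arbitrary: xs ys)
  case 0
  then show ?case by simp
next
  case (Suc n)
  obtain xs' a where xs: "xs = xs' @ [a]"
    using Suc.hyps(2) by (metis length_Suc_conv_rev)
  have len: "length ys = Suc n"
    using Suc.hyps(2) Suc.prems by (metis distinct_card)
  obtain ys' b where ys: "ys = ys' @ [b]"
    using len by (metis length_Suc_conv_rev)
  have n: "n = length xs'" "n = length ys'"
    using xs ys len Suc.hyps(2) by auto
  show ?case
  proof (cases "a = b")
    case True
    then have "set xs' = set ys'"
      using Suc.prems xs ys by auto
    then show ?thesis
      using Suc.hyps(1)[of xs' ys'] n xs ys True Suc.prems by (simp add: per_list_snoc)
  next
    case False
    \<comment> \<open>By induction the two prefixes may be reordered to \<open>zs @ [b]\<close> and
      \<open>zs @ [a]\<close>; the full lists then differ only in the order of their last two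
      points.\<close>
    obtain zs where zs: "set zs = set xs - {a, b}" "distinct zs"
      using finite_distinct_list by (metis finite_Diff finite_set)
    have seqs: "set xs' = set (zs @ [b])" "set ys' = set (zs @ [a])"
      using xs ys zs Suc.prems False by auto
    have dist: "distinct xs'" "distinct ys'" "distinct (zs @ [b])" "distinct (zs @ [a])"
      using xs ys zs Suc.prems by auto
    have subs: "set xs' \<subseteq> E" "set ys' \<subseteq> E"
      using xs ys Suc.prems by auto
    have "per_list w d r xs' = per_list w d r (zs @ [b])"
      by (rule Suc.hyps(1)[OF n(1) dist(1,3) seqs(1) subs(1)])
    moreover have "per_list w d r ys' = per_list w d r (zs @ [a])"
      by (rule Suc.hyps(1)[OF n(2) dist(2,4) seqs(2) subs(2)])
    moreover have "dist_removed d r (set zs) a + dist_removed d r (insert a (set zs)) b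
       = dist_removed d r (set zs) b + dist_removed d r (insert b (set zs)) a"
    proof (rule dist_removed_swap[OF assms(1)])
      show "a \<in> E" "b \<in> E" "a \<notin> set zs" "b \<notin> set zs" "set zs \<subseteq> E"
        using Suc.prems xs ys zs by auto
    qed (use False in auto)
    ultimately show ?thesis
      using xs ys seqs by (simp add: per_list_snoc)
  qed
qed

lemma per_set_eq_per_list:
  assumes "ultra_triple E w d" "distinct xs" "set xs = A" "A \<subseteq> E"
  shows "per_set w d r A = per_list w d r xs"
  unfolding per_set_def
proof (rule the_equality)
  show "\<forall>ys. distinct ys \<and> set ys = A \<longrightarrow> per_list w d r ys = per_list w d r xs"
    using per_list_cong_set[OF assms(1)] assms(2-) by blast
qed (use assms in blast)

lemma per_set_insert:
  assumes "ultra_triple E w d" "finite A" "insert a A \<subseteq> E" "a \<notin> A"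
  shows "per_set w d r (insert a A) = per_set w d r A + w a + dist_removed d r A a"
proof -
  obtain xs where xs: "set xs = A" "distinct xs"
    using finite_distinct_list[OF assms(2)] by blast
  have "per_set w d r (insert a A) = per_list w d r (xs @ [a])"
    using per_set_eq_per_list[OF assms(1)] xs assms by auto
  moreover have "per_set w d r A = per_list w d r xs"
    using per_set_eq_per_list[OF assms(1)] xs assms by auto
  ultimately show ?thesis
    using xs by (simp add: per_list_snoc)
qed

section \<open>Nearest-point matching and exchange\<close>

lemma nearest_point_matching:
  fixes d :: "'a \<Rightarrow> 'a \<Rightarrow> real"
  assumes "finite A" "finite B" "card A < card B"
  obtains u f where "u \<in> B" "inj_on f A" "f ` A \<subseteq> B - {u}" "\<And>a. a \<in> A \<Longrightarrow> d a (f a) \<le> d a u"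
proof -
  have "\<exists>u\<in>B. \<exists>f. inj_on f A \<and> f ` A \<subseteq> B - {u} \<and> (\<forall>a\<in>A. d a (f a) \<le> d a u)"
    using assms
  proof (induction A arbitrary: B rule: finite_induct)
    case empty
    then show ?case by (auto simp: card_gt_0_iff)
  next
    case (insert a A)
    then have "B \<noteq> {}" by auto
    then obtain b where b: "b \<in> B" "\<And>y. y \<in> B \<Longrightarrow> d a b \<le> d a y"
      \<comment> \<open>The new point \<open>a\<close> chooses first, from all of \<open>B\<close>.
        The point \<open>u\<close> left over after matching the others into \<open>B - {b}\<close>
        was available to \<open>a\<close> as well, so it is no closer to \<open>a\<close> than
        \<open>b\<close>.\<close>
      using arg_min_if_finite[OF insert.prems(1), of "d a"] not_less by blast
    have "card A < card (B - {b})"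
      using insert b by simp
    then obtain u f where uf: "u \<in> B - {b}" "inj_on f A" "f ` A \<subseteq> B - {b} - {u}"
        "\<forall>a\<in>A. d a (f a) \<le> d a u"
      using insert.IH[of "B - {b}"] insert.prems by blast
    have "inj_on (f(a := b)) (insert a A)"
      using uf(2,3) insert.hyps(2) by (auto simp: inj_on_def image_iff)
    moreover have "f(a := b) ` insert a A \<subseteq> B - {u}"
      using uf(1,3) b(1) by auto
    moreover have "\<forall>x\<in>insert a A. d x ((f(a := b)) x) \<le> d x u"
      using uf b(2) by auto
    ultimately show ?case
      using uf(1) by blast
  qed
  then show ?thesis using that by blast
qed

lemma dist_removed_exchange:
  assumes ut: "ultra_triple E w d" and "finite A" "finite B" "A \<subseteq> E" "B \<subseteq> E"
    and card: "card B = Suc (card A)"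
  obtains u where "u \<in> B - A" "dist_removed d r (B - {u}) u \<le> dist_removed d r A u"
proof -
  have "card (A - B) < card (B - A)"
    using card \<open>finite A\<close> \<open>finite B\<close> card_less_sym_Diff[of A B] by simp
  then obtain u f where u: "u \<in> B - A" and inj: "inj_on f (A - B)"
    and img: "f ` (A - B) \<subseteq> B - A - {u}"
    and near: "\<And>a. a \<in> A - B \<Longrightarrow> d a (f a) \<le> d a u"
    using nearest_point_matching[of "A - B" "B - A" d] \<open>finite A\<close> \<open>finite B\<close> by blast
  \<comment> \<open>Fixing the common points extends the matching to an injection of
    \<open>A\<close> into \<open>B - {u}\<close>, which is onto because both have the same
    size.\<close>
  define g where "g a = (if a \<in> B then a else f a)" for a
  have inj_g: "inj_on g A"
    using inj img unfolding g_def inj_on_def by (auto split: if_splits)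
  have "g ` A \<subseteq> B - {u}"
    using img u unfolding g_def by auto
  moreover have "card (g ` A) = card (B - {u})"
    using card u inj_g \<open>finite B\<close> by (simp add: card_image)
  ultimately have g_img: "g ` A = B - {u}"
    using \<open>finite B\<close> by (simp add: card_subset_eq)
  have closer: "d u (g a) \<le> d u a" if "a \<in> A" for a
  proof (cases "a \<in> B")
    case True
    then show ?thesis by (simp add: g_def)
  next
    case False
    then have a: "a \<in> A - B" "g a = f a" using that by (auto simp: g_def)
    then have fa: "f a \<in> B" "f a \<notin> A" "f a \<noteq> u" using img by auto
    have E: "a \<in> E" "u \<in> E" "f a \<in> E" using a fa u assms by auto
    have ne: "a \<noteq> u" "f a \<noteq> a" using a fa u by auto
    have "d u (f a) \<le> max (d u a) (d (f a) a)"
      using ultra_triple_max[OF ut, of u "f a" a] E ne fa by auto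
    moreover have "d (f a) a = d a (f a)" "d a u = d u a"
      using ultra_triple_sym[OF ut, of "f a" a] ultra_triple_sym[OF ut, of a u] E ne by auto
    ultimately show ?thesis
      using near[OF a(1)] a(2) by simp
  qed
  obtain S where S: "S \<subseteq> B - {u}" "card S = card (B - {u}) - r"
      "dist_removed d r (B - {u}) u = (\<Sum>x\<in>S. d u x)"
    using dist_removed_attained[of "B - {u}" r d u] \<open>finite B\<close> by auto
  \<comment> \<open>Pulling an optimal \<open>S\<close> back along \<open>g\<close> gives a set
    admissible for \<open>A\<close> whose points are at least as far from \<open>u\<close>.\<close>
  obtain T where T: "T \<subseteq> A" "S = g ` T"
    using S(1) g_img by (metis subset_imageE)
  have injT: "inj_on g T"
    using inj_g T(1) inj_on_subset by blast
  have "dist_removed d r (B - {u}) u = (\<Sum>a\<in>T. d u (g a))"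
    using S(3) T(2) injT by (simp add: sum.reindex)
  also have "\<dots> \<le> (\<Sum>a\<in>T. d u a)"
    using closer T(1) by (intro sum_mono) auto
  also have "\<dots> \<le> dist_removed d r A u"
  proof (rule dist_removed_ge[OF \<open>finite A\<close> T(1)])
    show "card T = card A - r"
      using S(2) T(2) injT card u \<open>finite B\<close> by (simp add: card_image)
  qed
  finally show ?thesis using that u by blast
qed

section \<open>Optimality of the greedy prefixes\<close>

theorem theorem3p4:
  fixes E C :: "'a set" and w :: "'a \<Rightarrow> real" and d :: "'a \<Rightarrow> 'a \<Rightarrow> real"
    and m r :: nat and cs :: "'a list"
  assumes "ultra_triple E w d"
    and "C \<subseteq> E" and "finite C"
    and "greedy_removed_permutation w d r m C cs"
  shows "\<forall>k\<in>{0..m}. max_perimeter_subset w d r k C (set (take k cs))"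
proof -
  have cs: "length cs = m" "distinct cs" "set cs \<subseteq> C"
    and greedy: "\<And>i x. i \<in> {1..m} \<Longrightarrow> x \<in> C - set (take (i - 1) cs) \<Longrightarrow>
        per_list w d r (take (i - 1) cs @ [x]) \<le> per_list w d r (take i cs)"
    using assms(4) unfolding greedy_removed_permutation_def by blast+
  have "max_perimeter_subset w d r k C (set (take k cs))" if "k \<le> m" for k
    using that
  proof (induction k)
    case 0
    have "A = {}" if "A \<subseteq> C" "card A = 0" for A
      using that assms(3) finite_subset[of A C] by auto
    then show ?case
      by (auto simp: max_perimeter_subset_def)
  next
    case (Suc k)
    let ?G = "set (take k cs)" and ?G' = "set (take (Suc k) cs)"
    have sub: "?G \<subseteq> C" "?G' \<subseteq> C"
      using cs set_take_subset by fast+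
    have G: "card ?G = k" and max: "\<And>A. A \<subseteq> C \<Longrightarrow> card A = k \<Longrightarrow> per_set w d r A \<le> per_set w d r ?G"
      using Suc unfolding max_perimeter_subset_def by auto
    have "per_set w d r B \<le> per_set w d r ?G'" if B: "B \<subseteq> C" "card B = Suc k" for B
    proof -
      have finB: "finite B" using B assms(3) finite_subset by blast
      have subE: "?G \<subseteq> E" "B \<subseteq> E" using B sub assms(2) by auto
      obtain u where u: "u \<in> B - ?G" and le: "dist_removed d r (B - {u}) u \<le> dist_removed d r ?G u"
        using dist_removed_exchange[OF assms(1) _ finB subE] B(2) G by auto
      have "per_set w d r B = per_set w d r (B - {u}) + w u + dist_removed d r (B - {u}) u"
        using per_set_insert[OF assms(1), of "B - {u}" u r] finB subE u
        by (auto simp: insert_absorb)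
      \<comment> \<open>\<open>B - {u}\<close> has \<open>k\<close> points, so the induction
        hypothesis bounds its perimeter by that of the greedy prefix.\<close>
      also have "\<dots> \<le> per_set w d r ?G + w u + dist_removed d r ?G u"
        using max[of "B - {u}"] le B u by (simp add: subset_iff)
      also have "\<dots> = per_list w d r (take k cs @ [u])"
        using per_set_eq_per_list[OF assms(1) _ refl subE(1)] cs(2) by (simp add: per_list_snoc)
      \<comment> \<open>Since \<open>u\<close> lies in \<open>C\<close> outside the prefix, it was a
        candidate in the next greedy choice.\<close>
      also have "\<dots> \<le> per_list w d r (take (Suc k) cs)"
        using greedy[of "Suc k" u] Suc.prems u B(1) by auto
      also have "\<dots> = per_set w d r ?G'"
        using per_set_eq_per_list[OF assms(1) _ refl, of "take (Suc k) cs" r] cs(2) sub(2) assms(2) by simp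
      finally show ?thesis .
    qed
    moreover have "card ?G' = Suc k"
      using cs Suc.prems by (simp add: distinct_card)
    ultimately show ?case
      using sub by (simp add: max_perimeter_subset_def)
  qed
  then show ?thesis by simp
qed

end
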